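(* Let $\Xi=\{0,1\}$ and let $d\in\mathbb{Z}^{N\times M}$ be feasible for (TR-IP), i.e. $x_{i,j}+d_{i,j}\in\{0,1\}$ for all $i\in[N],j\in[M]$ and $\sum_{i=1}^N\sum_{j=1}^M|d_{i,j}|\le\Delta$. Let $\delta_{i,j}=|d_{i,j}|$, $\beta_{i,j}=|x_{i+1,j}+d_{i+1,j}-x_{i,j}-d_{i,j}|$ and $\gamma_{i,j}=|x_{i,j+1}+d_{i,j+1}-x_{i,j}-d_{i,j}|$. Then $(d,\delta,\beta,\gamma)$ is a vertex of the polyhedron $P_\Delta$.
   Context: Setting: $N,M\in\mathbb{N}$, $[N]:=\{1,\dots,N\}$, $x\in\Xi^{N\times M}$, $\Delta\in\mathbb{N}$. The polyhedron $P_\Delta$ is the set of all real tuples $(d,\delta,\beta,\gamma)$, $d,\delta\in\mathbb{R}^{N\times M}$, $\beta\in\mathbb{R}^{(N-1)\times M}$, $\gamma\in\mathbb{R}^{N\times(M-1)}$, with - $\min\Xi\le x_{i,j}+d_{i,j}\le\max\Xi$ for $i\in[N],j\in[M]$; - $-\beta_{i,j}\le x_{i+1,j}+d_{i+1,j}-x_{i,j}-d_{i,j}\le\beta_{i,j}$ for $i\in[N-1],j\in[M]$; - $-\gamma_{i,j}\le x_{i,j+1}+d_{i,j+1}-x_{i,j}-d_{i,j}\le\gamma_{i,j}$ for $i\in[N],j\in[M-1]$; - $-\delta_{i,j}\le d_{i,j}\le\delta_{i,j}$ for $i\in[N],j\in[M]$; - $\sum_{i=1}^N\sum_{j=1}^M\delta_{i,j}\le\Delta$.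 *)

theory Defs
  imports "HOL-Analysis.Analysis" "HOL-Analysis.Finite_Function_Topology"
begin

text \<open>
  Matrices with a variable number of rows and columns are finitely supported functions of the
  index pair that vanish outside the index range. This type is a real vector space for all sizes
  at once, so tuples of matrices live in a product of real vector spaces, and the library's
  \<^const>\<open>extreme_point_of\<close> applies to sets of them.
\<close>

type_synonym matr = "nat \<times> nat \<Rightarrow>\<^sub>0 real"

abbreviation entry :: "matr \<Rightarrow> nat \<Rightarrow> nat \<Rightarrow> real" where
  "entry A i j \<equiv> Poly_Mapping.lookup A (i, j)"

text \<open>Indices start at 1; with \<^term>\<open>n = 0\<close> or \<^term>\<open>m = 0\<close> only the zero matrix remains.\<close>

definition matrices :: "real set \<Rightarrow> nat \<Rightarrow> nat \<Rightarrow> matr set" where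
  "matrices S n m =
     {A. Poly_Mapping.keys A \<subseteq> {1..n} \<times> {1..m} \<and> (\<forall>i\<in>{1..n}. \<forall>j\<in>{1..m}. entry A i j \<in> S)}"

definition TR_IP_feasible ::
    "real set \<Rightarrow> nat \<Rightarrow> nat \<Rightarrow> matr \<Rightarrow> nat \<Rightarrow> matr \<Rightarrow> bool" where
  "TR_IP_feasible \<Xi> N M x \<Delta> d \<longleftrightarrow>
     d \<in> matrices \<int> N M \<and>
     (\<forall>i\<in>{1..N}. \<forall>j\<in>{1..M}. entry x i j + entry d i j \<in> \<Xi>) \<and>
     (\<Sum>i=1..N. \<Sum>j=1..M. \<bar>entry d i j\<bar>) \<le> real \<Delta>"

text \<open>The set \<open>\<Xi>\<close> is meant to be finite and nonempty, so that its minimum and maximum exist.\<close>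

definition TR_polyhedron ::
    "real set \<Rightarrow> nat \<Rightarrow> nat \<Rightarrow> matr \<Rightarrow> nat \<Rightarrow> (matr \<times> matr \<times> matr \<times> matr) set" where
  "TR_polyhedron \<Xi> N M x \<Delta> =
     {(d, \<delta>, \<beta>, \<gamma>).
        d \<in> matrices UNIV N M \<and> \<delta> \<in> matrices UNIV N M \<and>
        \<beta> \<in> matrices UNIV (N - 1) M \<and> \<gamma> \<in> matrices UNIV N (M - 1) \<and>
        (\<forall>i\<in>{1..N}. \<forall>j\<in>{1..M}.
           Min \<Xi> \<le> entry x i j + entry d i j \<and> entry x i j + entry d i j \<le> Max \<Xi>) \<and>
        (\<forall>i\<in>{1..N - 1}. \<forall>j\<in>{1..M}.
           - entry \<beta> i j \<le> entry x (i + 1) j + entry d (i + 1) j - entry x i j - entry d i j \<and>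
           entry x (i + 1) j + entry d (i + 1) j - entry x i j - entry d i j \<le> entry \<beta> i j) \<and>
        (\<forall>i\<in>{1..N}. \<forall>j\<in>{1..M - 1}.
           - entry \<gamma> i j \<le> entry x i (j + 1) + entry d i (j + 1) - entry x i j - entry d i j \<and>
           entry x i (j + 1) + entry d i (j + 1) - entry x i j - entry d i j \<le> entry \<gamma> i j) \<and>
        (\<forall>i\<in>{1..N}. \<forall>j\<in>{1..M}.
           - entry \<delta> i j \<le> entry d i j \<and> entry d i j \<le> entry \<delta> i j) \<and>
        (\<Sum>i=1..N. \<Sum>j=1..M. entry \<delta> i j) \<le> real \<Delta>}"

end

theory Submission
  imports Defs
begin

text \<open>
  Suppose that \<open>(d, \<delta>, \<beta>, \<gamma>)\<close> lies strictly between two points of the polyhedron. Every entry of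
  \<open>x + d\<close> is \<open>0\<close> or \<open>1\<close>, hence an end of the interval \<open>[min \<Xi>, max \<Xi>] = [0, 1]\<close> to which the
  polyhedron confines these entries. An end of an interval is not a proper convex combination of
  other points of the interval, so both points have the component \<open>d\<close>. Once \<open>d\<close> is fixed, the
  remaining constraints bound every entry of \<open>\<delta>\<close>, \<open>\<beta>\<close>, \<open>\<gamma>\<close> from below by the absolute value that
  it has at the given point, so both points share these extremal entries too. For a larger \<open>\<Xi>\<close> the
  first step would fail, as \<open>x + d\<close> could then have entries strictly inside the interval.

  The arguments for all four components are instances of \<open>segment_between_entry_bounds\<close>.
\<close>

lemma lookup_scaleR:
  fixes f :: "'a \<Rightarrow>\<^sub>0 'b::real_vector"
  shows "Poly_Mapping.lookup (r *\<^sub>R f) k = r *\<^sub>R Poly_Mapping.lookup f k"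
proof -
  have "finite {k. r *\<^sub>R Poly_Mapping.lookup f k \<noteq> 0}"
    by (rule finite_subset[OF _ finite_keys[of f]]) (auto simp: in_keys_iff)
  then show ?thesis
    by (simp add: scaleR_poly_mapping_def)
qed

lemma proper_convex_combination_at_bound:
  fixes p b c u :: real
  assumes "p = (1 - u) * b + u * c" "0 < u" "u < 1"
    and "(p \<le> b \<and> p \<le> c) \<or> (b \<le> p \<and> c \<le> p)"
  shows "b = p \<and> c = p"
proof -
  have sum: "(1 - u) * (b - p) + u * (c - p) = 0"
    using assms(1) by (simp add: algebra_simps)
  \<comment> \<open>The two summands have the same sign, so both vanish.\<close>
  have "(0 \<le> (1 - u) * (b - p) \<and> 0 \<le> u * (c - p)) \<or> ((1 - u) * (b - p) \<le> 0 \<and> u * (c - p) \<le> 0)"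
    using assms(2-4) by (auto simp: mult_le_0_iff)
  with sum have "(1 - u) * (b - p) = 0 \<and> u * (c - p) = 0"
    by linarith
  then show ?thesis
    using assms(2,3) by simp
qed

text \<open>
  Whether the middle matrix bounds the two others from below or from above may vary with the entry:
  the zeros of \<open>x + d\<close> are lower bounds and the ones are upper bounds.
\<close>

lemma segment_between_entry_bounds:
  assumes comb: "A = (1 - u) *\<^sub>R B + u *\<^sub>R C" and u: "0 < u" "u < 1"
    and B: "B \<in> matrices UNIV n m" and C: "C \<in> matrices UNIV n m"
    and bound: "\<And>i j. i \<in> {1..n} \<Longrightarrow> j \<in> {1..m} \<Longrightarrow>
      (entry A i j \<le> entry B i j \<and> entry A i j \<le> entry C i j) \<or>
      (entry B i j \<le> entry A i j \<and> entry C i j \<le> entry A i j)"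
  shows "B = A \<and> C = A"
proof -
  have "entry B i j = entry A i j \<and> entry C i j = entry A i j" for i j
  proof (cases "i \<in> {1..n} \<and> j \<in> {1..m}")
    case True
    have "entry A i j = (1 - u) * entry B i j + u * entry C i j"
      by (simp add: comb lookup_add lookup_scaleR)
    then show ?thesis
      using proper_convex_combination_at_bound u bound True by blast
  next
    case False
    then have "entry B i j = 0" "entry C i j = 0"
      using B C by (auto simp: matrices_def in_keys_iff)
    then show ?thesis
      by (simp add: comb lookup_add lookup_scaleR)
  qed
  then show ?thesis
    by (auto intro!: poly_mapping_eqI)
qed

theorem theorem5:
  fixes N M \<Delta> :: nat and \<Xi> :: "real set" and x d \<delta> \<beta> \<gamma> :: matr
  assumes "\<Xi> = {0, 1}"
    and "x \<in> matrices \<Xi> N M"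
    and "TR_IP_feasible \<Xi> N M x \<Delta> d"
    and "\<delta> \<in> matrices UNIV N M"
    and "\<forall>i\<in>{1..N}. \<forall>j\<in>{1..M}. entry \<delta> i j = \<bar>entry d i j\<bar>"
    and "\<beta> \<in> matrices UNIV (N - 1) M"
    and "\<forall>i\<in>{1..N - 1}. \<forall>j\<in>{1..M}. entry \<beta> i j =
           \<bar>entry x (i + 1) j + entry d (i + 1) j - entry x i j - entry d i j\<bar>"
    and "\<gamma> \<in> matrices UNIV N (M - 1)"
    and "\<forall>i\<in>{1..N}. \<forall>j\<in>{1..M - 1}. entry \<gamma> i j =
           \<bar>entry x i (j + 1) + entry d i (j + 1) - entry x i j - entry d i j\<bar>"
  shows "(d, \<delta>, \<beta>, \<gamma>) extreme_point_of TR_polyhedron \<Xi> N M x \<Delta>"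
proof -
  have binary: "entry x i j + entry d i j = 0 \<or> entry x i j + entry d i j = 1"
    if "i \<in> {1..N}" "j \<in> {1..M}" for i j
    using assms(1,3) that by (auto simp: TR_IP_feasible_def)
  have d: "d \<in> matrices UNIV N M"
    using assms(3) by (simp add: TR_IP_feasible_def matrices_def)
  have "(\<Sum>i=1..N. \<Sum>j=1..M. entry \<delta> i j) = (\<Sum>i=1..N. \<Sum>j=1..M. \<bar>entry d i j\<bar>)"
    by (intro sum.cong refl) (use assms(5) in blast)
  then have budget: "(\<Sum>i=1..N. \<Sum>j=1..M. entry \<delta> i j) \<le> real \<Delta>"
    using assms(3) by (simp add: TR_IP_feasible_def)
  have box: "0 \<le> entry x i j + entry d i j \<and> entry x i j + entry d i j \<le> 1"
    if "i \<in> {1..N}" "j \<in> {1..M}" for i j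
    using binary[OF that] by auto
  have abs_bounds: "- \<bar>r\<bar> \<le> r \<and> r \<le> \<bar>r\<bar>" for r :: real
    by auto
  have feasible: "(d, \<delta>, \<beta>, \<gamma>) \<in> TR_polyhedron \<Xi> N M x \<Delta>"
    unfolding TR_polyhedron_def
    using d assms(1,4-9) budget box abs_bounds by simp
  have "(d, \<delta>, \<beta>, \<gamma>) \<notin> open_segment p q"
    if p: "p \<in> TR_polyhedron \<Xi> N M x \<Delta>" and q: "q \<in> TR_polyhedron \<Xi> N M x \<Delta>" for p q
  proof
    assume "(d, \<delta>, \<beta>, \<gamma>) \<in> open_segment p q"
    then obtain u where "p \<noteq> q" and u: "0 < u" "u < 1"
      and comb: "(d, \<delta>, \<beta>, \<gamma>) = (1 - u) *\<^sub>R p + u *\<^sub>R q"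
      by (auto simp: in_segment)
    obtain d1 \<delta>1 \<beta>1 \<gamma>1 where p_eq: "p = (d1, \<delta>1, \<beta>1, \<gamma>1)" by (cases p)
    obtain d2 \<delta>2 \<beta>2 \<gamma>2 where q_eq: "q = (d2, \<delta>2, \<beta>2, \<gamma>2)" by (cases q)
    note p_in = p[unfolded p_eq TR_polyhedron_def mem_Collect_eq prod.case]
    note q_in = q[unfolded q_eq TR_polyhedron_def mem_Collect_eq prod.case]
    have comb_d: "d = (1 - u) *\<^sub>R d1 + u *\<^sub>R d2"
      and comb_\<delta>: "\<delta> = (1 - u) *\<^sub>R \<delta>1 + u *\<^sub>R \<delta>2"
      and comb_\<beta>: "\<beta> = (1 - u) *\<^sub>R \<beta>1 + u *\<^sub>R \<beta>2"
      and comb_\<gamma>: "\<gamma> = (1 - u) *\<^sub>R \<gamma>1 + u *\<^sub>R \<gamma>2"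
      using comb by (simp_all add: p_eq q_eq)
    have d_eq: "d1 = d \<and> d2 = d"
    proof (rule segment_between_entry_bounds[OF comb_d u])
      show "d1 \<in> matrices UNIV N M" "d2 \<in> matrices UNIV N M"
        using p_in q_in by blast+
      fix i j assume ij: "i \<in> {1..N}" "j \<in> {1..M}"
      have "0 \<le> entry x i j + entry d1 i j \<and> entry x i j + entry d1 i j \<le> 1"
        "0 \<le> entry x i j + entry d2 i j \<and> entry x i j + entry d2 i j \<le> 1"
        using p_in q_in ij assms(1) by auto
      with binary[OF ij]
      show "(entry d i j \<le> entry d1 i j \<and> entry d i j \<le> entry d2 i j) \<or>
          (entry d1 i j \<le> entry d i j \<and> entry d2 i j \<le> entry d i j)"
        by linarith
    qed
    have "\<delta>1 = \<delta> \<and> \<delta>2 = \<delta>"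
    proof (rule segment_between_entry_bounds[where n = N and m = M, OF comb_\<delta> u], goal_cases)
      case (3 i j)
      have "- entry \<delta>1 i j \<le> entry d i j \<and> entry d i j \<le> entry \<delta>1 i j"
        "- entry \<delta>2 i j \<le> entry d i j \<and> entry d i j \<le> entry \<delta>2 i j"
        using 3 p_in q_in d_eq by auto
      then show ?case
        using 3 assms(5) by (simp add: abs_le_iff)
    qed (use p_in q_in in blast)+
    moreover have "\<beta>1 = \<beta> \<and> \<beta>2 = \<beta>"
    proof (rule segment_between_entry_bounds[where n = "N - 1" and m = M, OF comb_\<beta> u], goal_cases)
      case (3 i j)
      let ?r = "entry x (i + 1) j + entry d (i + 1) j - entry x i j - entry d i j"
      have "- entry \<beta>1 i j \<le> ?r \<and> ?r \<le> entry \<beta>1 i j" "- entry \<beta>2 i j \<le> ?r \<and> ?r \<le> entry \<beta>2 i j"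
        using 3 p_in q_in d_eq by auto
      moreover have "entry \<beta> i j = \<bar>?r\<bar>"
        using 3 assms(7) by blast
      ultimately show ?case
        by linarith
    qed (use p_in q_in in blast)+
    moreover have "\<gamma>1 = \<gamma> \<and> \<gamma>2 = \<gamma>"
    proof (rule segment_between_entry_bounds[where n = N and m = "M - 1", OF comb_\<gamma> u], goal_cases)
      case (3 i j)
      let ?r = "entry x i (j + 1) + entry d i (j + 1) - entry x i j - entry d i j"
      have "- entry \<gamma>1 i j \<le> ?r \<and> ?r \<le> entry \<gamma>1 i j" "- entry \<gamma>2 i j \<le> ?r \<and> ?r \<le> entry \<gamma>2 i j"
        using 3 p_in q_in d_eq by auto
      moreover have "entry \<gamma> i j = \<bar>?r\<bar>"
        using 3 assms(9) by blast
      ultimately show ?case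
        by linarith
    qed (use p_in q_in in blast)+
    ultimately show False
      using \<open>p \<noteq> q\<close> d_eq by (simp add: p_eq q_eq)
  qed
  with feasible show ?thesis
    by (simp add: extreme_point_of_def)
qed

end
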